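(* Let $\mathbb{F}$ be a field of characteristic not equal to $2$ with $|\mathbb{F}|\ge 4$, let $\mathcal{A}$ be a unital algebra over $\mathbb{F}$, and let $\mathcal{B}$ be an algebra containing $\mathcal{A}$ and sharing the same identity $I$ with $\mathcal{A}$, regarded as an $\mathcal{A}$-bimodule via the multiplication and addition of $\mathcal{B}$. Let $P\in\mathcal{A}$ be a non-trivial idempotent, $Q=I-P$, $E_1=P$, $E_2=Q$, $\mathcal{A}_{ij}=E_i\mathcal{A}E_j$, $\mathcal{B}_{ij}=E_i\mathcal{B}E_j$, and assume that every element of $\mathcal{A}_{11}$ is a linear combination of invertible elements of $\mathcal{A}_{11}$ and every element of $\mathcal{A}_{22}$ is a linear combination of invertible elements of $\mathcal{A}_{22}$. Let $\mathcal{T}_{\mathcal{A}}=\{A\in\mathcal{A}: QAP=0\}$. Suppose $\mathcal{A}_{12}$ is faithful with respect to $\mathcal{B}$, $C(\mathcal{T}_{\mathcal{A}},\mathcal{B})=\mathbb{F}I$, and $[\mathcal{A}_{11},\mathcal{A}_{11}]$ separates $\mathcal{B}_{12}$. If $\delta\in L(\mathcal{A},\mathcal{B})$ is Jordan derivable at some $C\in\mathcal{A}_{11}+\mathcal{A}_{12}$, then $\delta$ is a derivation. In particular, every $C\in\mathcal{A}_{11}+\mathcal{A}_{12}$ is a Jordan all-derivable point of $L(\mathcal{A},\mathcal{B})$.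
   Context: $L(\mathcal{A},\mathcal{B})$ is the set of all linear mappings from $\mathcal{A}$ to $\mathcal{B}$. For a subalgebra $\mathcal{S}\subseteq\mathcal{B}$, $C(\mathcal{S},\mathcal{B})=\{M\in\mathcal{B}: AM=MA\text{ for every }A\in\mathcal{S}\}$. A mapping $\delta\in L(\mathcal{A},\mathcal{B})$ is a derivation if $\delta(AB)=\delta(A)B+A\delta(B)$ for all $A,B\in\mathcal{A}$; it is a Jordan derivation if $\delta(AB+BA)=\delta(A)B+A\delta(B)+\delta(B)A+B\delta(A)$ for all $A,B\in\mathcal{A}$; it is Jordan derivable at $C\in\mathcal{A}$ if the latter identity holds for all $A,B\in\mathcal{A}$ with $AB=C$. An element $C\in\mathcal{A}$ is a Jordan all-derivable point of $L(\mathcal{A},\mathcal{B})$ if every $\delta\in L(\mathcal{A},\mathcal{B})$ that is Jordan derivable at $C$ is a Jordan derivation. Non-trivial idempotent means an idempotent different from $0$ and $I$. Invertible in $\mathcal{A}_{ii}$ means invertible with respect to the unit $E_i$, with inverse in $\mathcal{A}_{ii}$. $\mathcal{A}_{12}$ is faithful with respect to $\mathcal{B}$ if for every $M\in\mathcal{B}$: $M\mathcal{A}_{12}=\{0\}$ implies $MP=0$, and $\mathcal{A}_{12}M=\{0\}$ implies $QM=0$. $[\mathcal{A}_{11},\mathcal{A}_{11}]=\{A_{11}B_{11}-B_{11}A_{11}: A_{11},B_{11}\in\mathcal{A}_{11}\}$. A subset $\mathcal{S}$ of an algebra separates a left module $\mathcal{M}$ over that algebra if for every $M\in\mathcal{M}$,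 $\mathcal{S}M=\{0\}$ implies $M=0$; here $\mathcal{B}_{12}$ is a left $\mathcal{A}_{11}$-module under multiplication in $\mathcal{B}$. *)

theory Defs
  imports Complex_Main
    "HOL-Library.Set_Algebras"
begin

text \<open>
  An associative unital algebra over a field: the carrier is the whole type \<open>'b\<close>, and scalar
  multiplication is an explicit parameter, since the base field is arbitrary.
\<close>

locale unital_algebra = vector_space scale
  for scale :: "'f::field \<Rightarrow> 'b::ring_1 \<Rightarrow> 'b" +
  assumes scale_mult_left: "scale c x * y = scale c (x * y)"
    and scale_mult_right: "x * scale c y = scale c (x * y)"

definition unital_subalgebra :: "('f::field \<Rightarrow> 'b::ring_1 \<Rightarrow> 'b) \<Rightarrow> 'b set \<Rightarrow> bool" where
  "unital_subalgebra scale A \<longleftrightarrow>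
     module.subspace scale A \<and> 1 \<in> A \<and> (\<forall>X\<in>A. \<forall>Y\<in>A. X * Y \<in> A)"

text \<open>
  Throughout, \<open>\<B>\<close> is the type \<open>'b\<close> and \<open>\<A>\<close> is a subset of it. A map from \<open>\<A>\<close> to \<open>\<B>\<close> is
  represented by a total function whose values outside \<open>\<A>\<close> are never constrained or used.
\<close>

definition linear_maps :: "('f::field \<Rightarrow> 'b::ring_1 \<Rightarrow> 'b) \<Rightarrow> 'b set \<Rightarrow> ('b \<Rightarrow> 'b) set" where
  "linear_maps scale A =
     {\<delta>. (\<forall>X\<in>A. \<forall>Y\<in>A. \<delta> (X + Y) = \<delta> X + \<delta> Y) \<and>
         (\<forall>c. \<forall>X\<in>A. \<delta> (scale c X) = scale c (\<delta> X))}"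

definition derivation :: "('f::field \<Rightarrow> 'b::ring_1 \<Rightarrow> 'b) \<Rightarrow> 'b set \<Rightarrow> ('b \<Rightarrow> 'b) \<Rightarrow> bool" where
  "derivation scale A \<delta> \<longleftrightarrow> \<delta> \<in> linear_maps scale A \<and>
     (\<forall>X\<in>A. \<forall>Y\<in>A. \<delta> (X * Y) = \<delta> X * Y + X * \<delta> Y)"

definition jordan_derivation ::
  "('f::field \<Rightarrow> 'b::ring_1 \<Rightarrow> 'b) \<Rightarrow> 'b set \<Rightarrow> ('b \<Rightarrow> 'b) \<Rightarrow> bool" where
  "jordan_derivation scale A \<delta> \<longleftrightarrow> \<delta> \<in> linear_maps scale A \<and>
     (\<forall>X\<in>A. \<forall>Y\<in>A. \<delta> (X * Y + Y * X) = \<delta> X * Y + X * \<delta> Y + \<delta> Y * X + Y * \<delta> X)"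

definition jordan_derivable_at ::
  "('f::field \<Rightarrow> 'b::ring_1 \<Rightarrow> 'b) \<Rightarrow> 'b set \<Rightarrow> 'b \<Rightarrow> ('b \<Rightarrow> 'b) \<Rightarrow> bool" where
  "jordan_derivable_at scale A C \<delta> \<longleftrightarrow> \<delta> \<in> linear_maps scale A \<and>
     (\<forall>X\<in>A. \<forall>Y\<in>A. X * Y = C \<longrightarrow>
        \<delta> (X * Y + Y * X) = \<delta> X * Y + X * \<delta> Y + \<delta> Y * X + Y * \<delta> X)"

definition jordan_all_derivable_point ::
  "('f::field \<Rightarrow> 'b::ring_1 \<Rightarrow> 'b) \<Rightarrow> 'b set \<Rightarrow> 'b \<Rightarrow> bool" where
  "jordan_all_derivable_point scale A C \<longleftrightarrow> C \<in> A \<and>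
     (\<forall>\<delta>\<in>linear_maps scale A. jordan_derivable_at scale A C \<delta> \<longrightarrow> jordan_derivation scale A \<delta>)"

definition centralizer :: "'b::ring_1 set \<Rightarrow> 'b set" where
  "centralizer S = {M. \<forall>X\<in>S. X * M = M * X}"

definition peirce :: "'b::ring_1 \<Rightarrow> 'b set \<Rightarrow> 'b \<Rightarrow> 'b set" where
  "peirce E A F = {E * X * F |X. X \<in> A}"

definition corner_invertible :: "'b::ring_1 \<Rightarrow> 'b set \<Rightarrow> 'b set" where
  "corner_invertible E A =
     {X \<in> peirce E A E. \<exists>Y\<in>peirce E A E. X * Y = E \<and> Y * X = E}"

definition triangular_part :: "'b::ring_1 \<Rightarrow> 'b set \<Rightarrow> 'b set" where
  "triangular_part P A = {X \<in> A. (1 - P) * X * P = 0}"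

definition faithful_corner :: "'b::ring_1 \<Rightarrow> 'b set \<Rightarrow> bool" where
  "faithful_corner P A \<longleftrightarrow>
     (\<forall>M. (\<forall>X\<in>peirce P A (1 - P). M * X = 0) \<longrightarrow> M * P = 0) \<and>
     (\<forall>M. (\<forall>X\<in>peirce P A (1 - P). X * M = 0) \<longrightarrow> (1 - P) * M = 0)"

text \<open>The set of commutators itself, not its linear span.\<close>

definition commutators :: "'b::ring_1 set \<Rightarrow> 'b set" where
  "commutators S = {X * Y - Y * X |X Y. X \<in> S \<and> Y \<in> S}"

definition separates :: "'b::ring_1 set \<Rightarrow> 'b set \<Rightarrow> bool" where
  "separates S N \<longleftrightarrow> (\<forall>M\<in>N. (\<forall>X\<in>S. X * M = 0) \<longrightarrow> M = 0)"

end

theory Submission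
  imports Defs
begin

text \<open>
  With \<open>J X Y = \<delta> (X Y + Y X) - (\<delta> X Y + X \<delta> Y + \<delta> Y X + Y \<delta> X)\<close>, a map that is Jordan derivable
  at \<open>C = P C\<close> satisfies \<open>J X Y = 0\<close> for \<open>X = a + m\<close> and \<open>Y = a\<^sup>-\<^sup>1 C + (1 - a\<^sup>-\<^sup>1 m) w\<close>, where \<open>a\<close> is
  invertible in \<open>\<A>\<^sub>1\<^sub>1\<close>, \<open>m \<in> \<A>\<^sub>1\<^sub>2\<close> and \<open>w \<in> Q \<A>\<close>. Comparing \<open>m\<close> with \<open>- m\<close> splits this into
  its homogeneous parts, which no longer involve \<open>C\<close>. After subtraction of an inner derivation they
  force \<open>\<delta>\<close> to respect the Peirce decomposition: the component of \<open>\<delta>\<close> from \<open>\<A>\<^sub>2\<^sub>1\<close> to \<open>\<B>\<^sub>1\<^sub>2\<close>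
  and the one from \<open>\<A>\<^sub>1\<^sub>2\<close> to \<open>\<B>\<^sub>2\<^sub>1\<close> reverse the action of \<open>\<A>\<^sub>1\<^sub>1\<close> and are therefore annihilated
  by commutators. Then \<open>\<delta> 1\<close> centralises \<open>\<T>\<^sub>\<A>\<close>, so it is a scalar \<open>\<lambda>\<close>, and \<open>\<delta> - \<lambda>\<close> is a derivation
  on \<open>\<T>\<^sub>\<A>\<close>; faithfulness of \<open>\<A>\<^sub>1\<^sub>2\<close> carries this over to \<open>\<A>\<^sub>2\<^sub>1\<close> once \<open>\<lambda> = 0\<close>.
\<close>

section \<open>Peirce calculus for the corners of \<open>A\<close> and of the whole algebra\<close>

locale faithful_peirce = unital_algebra scale
  for scale :: "'f::field \<Rightarrow> 'b::ring_1 \<Rightarrow> 'b" +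
  fixes A :: "'b set" and P Q :: 'b
  assumes char_neq_2: "CHAR('f) \<noteq> 2"
    and subalgebra: "unital_subalgebra scale A"
    and P_in [simp]: "P \<in> A" and P_idem [simp]: "P * P = P" and P_neq_0: "P \<noteq> 0"
    and Q_eq: "Q = 1 - P"
    and corner_span: "peirce P A P \<subseteq> span (corner_invertible P A)"
    and faithful: "faithful_corner P A"
    and centre: "centralizer (triangular_part P A) = range (\<lambda>c. scale c 1)"
    and separating: "separates (commutators (peirce P A P)) (peirce P UNIV Q)"
begin

abbreviation "B11 \<equiv> peirce P UNIV P"
abbreviation "B12 \<equiv> peirce P UNIV Q"
abbreviation "B21 \<equiv> peirce Q UNIV P"
abbreviation "B22 \<equiv> peirce Q UNIV Q"

lemma subspace_A: "subspace A"
  using subalgebra by (simp add: unital_subalgebra_def)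

lemma in_A [simp]:
  "0 \<in> A" "1 \<in> A" "Q \<in> A"
  "X \<in> A \<Longrightarrow> Y \<in> A \<Longrightarrow> X + Y \<in> A"
  "X \<in> A \<Longrightarrow> Y \<in> A \<Longrightarrow> X - Y \<in> A"
  "X \<in> A \<Longrightarrow> - X \<in> A"
  "X \<in> A \<Longrightarrow> Y \<in> A \<Longrightarrow> X * Y \<in> A"
  "X \<in> A \<Longrightarrow> scale c X \<in> A"
  using subspace_A subalgebra unfolding unital_subalgebra_def Q_eq
  by (auto intro: subspace_0 subspace_add subspace_diff subspace_neg subspace_scale)

lemma Q_simps [simp]:
  "Q * Q = Q" "P * Q = 0" "Q * P = 0"
  "P * (P * X) = P * X" "Q * (Q * X) = Q * X" "P * (Q * X) = 0" "Q * (P * X) = 0"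
proof -
  show *: "Q * Q = Q" "P * Q = 0" "Q * P = 0"
    by (simp_all add: Q_eq algebra_simps)
  show "P * (P * X) = P * X" "Q * (Q * X) = Q * X" "P * (Q * X) = 0" "Q * (P * X) = 0"
    by (simp_all add: mult.assoc [symmetric] *)
qed

lemma PQ: "P + Q = 1"
  by (simp add: Q_eq)

text \<open>Characteristic different from 2 enters here. As a simp rule it also finishes the corner
  comparisons below in which a compressed term occurs twice.\<close>

lemma double_eq_0 [simp]: "X + X = 0 \<longleftrightarrow> X = (0::'b)"
proof
  assume "X + X = 0"
  then have "scale 2 X = 0"
    using scale_left_distrib [of 1 1 X] by simp
  moreover have "(2::'f) \<noteq> 0"
  proof
    assume "(2::'f) = 0"
    then have "of_nat 2 = (0::'f)" by simp
    then have "CHAR('f) dvd 2" by (simp only: of_nat_eq_0_iff_char_dvd)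
    then have "CHAR('f) \<le> 2" by (auto dest: dvd_imp_le)
    with \<open>CHAR('f) dvd 2\<close> have "CHAR('f) = 0 \<or> CHAR('f) = 1 \<or> CHAR('f) = 2" by linarith
    with \<open>CHAR('f) dvd 2\<close> char_neq_2 show False by auto
  qed
  ultimately show "X = 0" by simp
qed simp

text \<open>Two absorption equations are easier to compute with than an existential. Both choices of
  \<open>S\<close> are closed under multiplication by \<open>P\<close> and \<open>Q\<close>.\<close>

lemma peirce_iff:
  assumes "E \<in> {P, Q}" "F \<in> {P, Q}" "S \<in> {A, UNIV}"
  shows "X \<in> peirce E S F \<longleftrightarrow> X \<in> S \<and> E * X = X \<and> X * F = X"
proof
  assume "X \<in> peirce E S F"
  then obtain Y where "X = E * Y * F" "Y \<in> S" by (auto simp: peirce_def)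
  then show "X \<in> S \<and> E * X = X \<and> X * F = X"
    using assms by (auto simp: mult.assoc)
next
  assume "X \<in> S \<and> E * X = X \<and> X * F = X"
  then show "X \<in> peirce E S F"
    unfolding peirce_def by (auto intro: exI [of _ X])
qed

lemma
  shows B11_iff: "X \<in> B11 \<longleftrightarrow> P * X = X \<and> X * P = X"
    and B12_iff: "X \<in> B12 \<longleftrightarrow> P * X = X \<and> X * Q = X"
    and B21_iff: "X \<in> B21 \<longleftrightarrow> Q * X = X \<and> X * P = X"
    and B22_iff: "X \<in> B22 \<longleftrightarrow> Q * X = X \<and> X * Q = X"
    and A11_iff: "X \<in> peirce P A P \<longleftrightarrow> X \<in> A \<and> X \<in> B11"
    and A12_iff: "X \<in> peirce P A Q \<longleftrightarrow> X \<in> A \<and> X \<in> B12"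
  by (simp_all add: peirce_iff)

lemmas B_iffs = B11_iff B12_iff B21_iff B22_iff

lemma P_left: "P * X = X \<Longrightarrow> P * (X * Y) = X * Y \<and> Q * X = 0 \<and> Q * (X * Y) = 0"
  by (metis mult.assoc mult_zero_left Q_simps(3))

lemma Q_left: "Q * X = X \<Longrightarrow> Q * (X * Y) = X * Y \<and> P * X = 0 \<and> P * (X * Y) = 0"
  by (metis mult.assoc mult_zero_left Q_simps(2))

lemma P_right: "X * P = X \<Longrightarrow> X * (P * Y) = X * Y \<and> X * Q = 0 \<and> X * (Q * Y) = 0"
  by (metis mult.assoc mult_zero_left mult_zero_right Q_simps(2))

lemma Q_right: "X * Q = X \<Longrightarrow> X * (Q * Y) = X * Y \<and> X * P = 0 \<and> X * (P * Y) = 0"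
  by (metis mult.assoc mult_zero_left mult_zero_right Q_simps(3))

lemma PQ_right: "X * P = X \<Longrightarrow> Q * Y = Y \<Longrightarrow> X * Y = 0 \<and> X * (Y * Z) = 0"
  by (metis mult.assoc mult_zero_left mult_zero_right Q_simps(2))

lemma QP_right: "X * Q = X \<Longrightarrow> P * Y = Y \<Longrightarrow> X * Y = 0 \<and> X * (Y * Z) = 0"
  by (metis mult.assoc mult_zero_left mult_zero_right Q_simps(3))

text \<open>Each rule is paired with a version carrying a trailing factor, so that it still fires
  after products have been reassociated to the right.\<close>

lemma B_unit [simp]:
  "X \<in> B11 \<Longrightarrow> P * X = X" "X \<in> B11 \<Longrightarrow> P * (X * Y) = X * Y"
  "X \<in> B11 \<Longrightarrow> Q * X = 0" "X \<in> B11 \<Longrightarrow> Q * (X * Y) = 0"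
  "X \<in> B11 \<Longrightarrow> X * P = X" "X \<in> B11 \<Longrightarrow> X * (P * Y) = X * Y"
  "X \<in> B11 \<Longrightarrow> X * Q = 0" "X \<in> B11 \<Longrightarrow> X * (Q * Y) = 0"
  "X \<in> B12 \<Longrightarrow> P * X = X" "X \<in> B12 \<Longrightarrow> P * (X * Y) = X * Y"
  "X \<in> B12 \<Longrightarrow> Q * X = 0" "X \<in> B12 \<Longrightarrow> Q * (X * Y) = 0"
  "X \<in> B12 \<Longrightarrow> X * P = 0" "X \<in> B12 \<Longrightarrow> X * (P * Y) = 0"
  "X \<in> B12 \<Longrightarrow> X * Q = X" "X \<in> B12 \<Longrightarrow> X * (Q * Y) = X * Y"
  "X \<in> B21 \<Longrightarrow> P * X = 0" "X \<in> B21 \<Longrightarrow> P * (X * Y) = 0"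
  "X \<in> B21 \<Longrightarrow> Q * X = X" "X \<in> B21 \<Longrightarrow> Q * (X * Y) = X * Y"
  "X \<in> B21 \<Longrightarrow> X * P = X" "X \<in> B21 \<Longrightarrow> X * (P * Y) = X * Y"
  "X \<in> B21 \<Longrightarrow> X * Q = 0" "X \<in> B21 \<Longrightarrow> X * (Q * Y) = 0"
  "X \<in> B22 \<Longrightarrow> P * X = 0" "X \<in> B22 \<Longrightarrow> P * (X * Y) = 0"
  "X \<in> B22 \<Longrightarrow> Q * X = X" "X \<in> B22 \<Longrightarrow> Q * (X * Y) = X * Y"
  "X \<in> B22 \<Longrightarrow> X * P = 0" "X \<in> B22 \<Longrightarrow> X * (P * Y) = 0"
  "X \<in> B22 \<Longrightarrow> X * Q = X" "X \<in> B22 \<Longrightarrow> X * (Q * Y) = X * Y"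
  by (metis B_iffs P_left Q_left P_right Q_right)+

lemma B_orthogonal [simp]:
  "X \<in> B11 \<Longrightarrow> Y \<in> B21 \<Longrightarrow> X * Y = 0" "X \<in> B11 \<Longrightarrow> Y \<in> B21 \<Longrightarrow> X * (Y * Z) = 0"
  "X \<in> B11 \<Longrightarrow> Y \<in> B22 \<Longrightarrow> X * Y = 0" "X \<in> B11 \<Longrightarrow> Y \<in> B22 \<Longrightarrow> X * (Y * Z) = 0"
  "X \<in> B21 \<Longrightarrow> Y \<in> B21 \<Longrightarrow> X * Y = 0" "X \<in> B21 \<Longrightarrow> Y \<in> B21 \<Longrightarrow> X * (Y * Z) = 0"
  "X \<in> B21 \<Longrightarrow> Y \<in> B22 \<Longrightarrow> X * Y = 0" "X \<in> B21 \<Longrightarrow> Y \<in> B22 \<Longrightarrow> X * (Y * Z) = 0"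
  "X \<in> B12 \<Longrightarrow> Y \<in> B11 \<Longrightarrow> X * Y = 0" "X \<in> B12 \<Longrightarrow> Y \<in> B11 \<Longrightarrow> X * (Y * Z) = 0"
  "X \<in> B12 \<Longrightarrow> Y \<in> B12 \<Longrightarrow> X * Y = 0" "X \<in> B12 \<Longrightarrow> Y \<in> B12 \<Longrightarrow> X * (Y * Z) = 0"
  "X \<in> B22 \<Longrightarrow> Y \<in> B11 \<Longrightarrow> X * Y = 0" "X \<in> B22 \<Longrightarrow> Y \<in> B11 \<Longrightarrow> X * (Y * Z) = 0"
  "X \<in> B22 \<Longrightarrow> Y \<in> B12 \<Longrightarrow> X * Y = 0" "X \<in> B22 \<Longrightarrow> Y \<in> B12 \<Longrightarrow> X * (Y * Z) = 0"
  by (metis B_iffs PQ_right QP_right)+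

lemma B_mult [simp]:
  "X \<in> B11 \<Longrightarrow> Y \<in> B11 \<Longrightarrow> X * Y \<in> B11" "X \<in> B11 \<Longrightarrow> Y \<in> B12 \<Longrightarrow> X * Y \<in> B12"
  "X \<in> B12 \<Longrightarrow> Y \<in> B21 \<Longrightarrow> X * Y \<in> B11" "X \<in> B12 \<Longrightarrow> Y \<in> B22 \<Longrightarrow> X * Y \<in> B12"
  "X \<in> B21 \<Longrightarrow> Y \<in> B11 \<Longrightarrow> X * Y \<in> B21" "X \<in> B21 \<Longrightarrow> Y \<in> B12 \<Longrightarrow> X * Y \<in> B22"
  "X \<in> B22 \<Longrightarrow> Y \<in> B21 \<Longrightarrow> X * Y \<in> B21" "X \<in> B22 \<Longrightarrow> Y \<in> B22 \<Longrightarrow> X * Y \<in> B22"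
  unfolding B_iffs by (metis mult.assoc)+

lemma B_diff [simp]:
  "X \<in> B11 \<Longrightarrow> Y \<in> B11 \<Longrightarrow> X - Y \<in> B11" "X \<in> B12 \<Longrightarrow> Y \<in> B12 \<Longrightarrow> X - Y \<in> B12"
  "X \<in> B21 \<Longrightarrow> Y \<in> B21 \<Longrightarrow> X - Y \<in> B21" "X \<in> B22 \<Longrightarrow> Y \<in> B22 \<Longrightarrow> X - Y \<in> B22"
  unfolding B_iffs by (simp_all add: algebra_simps)

lemma B_add [simp]:
  "X \<in> B11 \<Longrightarrow> Y \<in> B11 \<Longrightarrow> X + Y \<in> B11" "X \<in> B12 \<Longrightarrow> Y \<in> B12 \<Longrightarrow> X + Y \<in> B12"
  unfolding B_iffs by (simp_all add: algebra_simps)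

lemma B_basic [simp]: "P \<in> B11" "Q \<in> B22" "0 \<in> B12" "0 \<in> B22"
    "P * X * P \<in> B11" "P * X * Q \<in> B12" "Q * X * P \<in> B21" "Q * X * Q \<in> B22"
    "P * (X * P) \<in> B11" "P * (X * Q) \<in> B12" "Q * (X * P) \<in> B21" "Q * (X * Q) \<in> B22"
  unfolding B_iffs by (simp_all add: mult.assoc)

lemma peirce_decomposition: "X = P * X * P + P * X * Q + Q * X * P + Q * X * Q"
proof -
  have "X = (P + Q) * X * (P + Q)" by (simp add: PQ)
  then show ?thesis by (simp add: algebra_simps)
qed

section \<open>Faithfulness, separation and spanning as proof rules\<close>

lemma faithful_left:
  assumes "X * P = X" "\<And>M. M \<in> A \<Longrightarrow> M \<in> B12 \<Longrightarrow> X * M = 0"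
  shows "X = 0"
proof -
  have "\<forall>M\<in>peirce P A Q. X * M = 0" using assms(2) A12_iff by blast
  then have "X * P = 0" using faithful unfolding faithful_corner_def Q_eq [symmetric] by blast
  then show ?thesis using assms(1) by simp
qed

lemma faithful_right:
  assumes "Q * X = X" "\<And>M. M \<in> A \<Longrightarrow> M \<in> B12 \<Longrightarrow> M * X = 0"
  shows "X = 0"
proof -
  have "\<forall>M\<in>peirce P A Q. M * X = 0" using assms(2) A12_iff by blast
  then have "Q * X = 0" using faithful unfolding faithful_corner_def Q_eq [symmetric] by blast
  then show ?thesis using assms(1) by simp
qed

text \<open>The second hypothesis makes every commutator kill \<open>X\<close>. Writing both orders
  of \<open>a\<close> and \<open>b\<close> suits elements on which the corner acts in reversed
  order.\<close>

lemma separated: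
  assumes "X \<in> B12"
    and "\<And>a b. a \<in> A \<Longrightarrow> a \<in> B11 \<Longrightarrow> b \<in> A \<Longrightarrow> b \<in> B11 \<Longrightarrow> a * b * X = b * a * X"
  shows "X = 0"
proof -
  have "Y * X = 0" if "Y \<in> commutators (peirce P A P)" for Y
    using that assms(2) by (auto simp: commutators_def A11_iff left_diff_distrib)
  then show ?thesis using separating assms(1) unfolding separates_def by blast
qed

text \<open>The elements of \<open>A\<close> satisfying \<open>\<Phi>\<close> form a subspace, so by
  \<open>corner_span\<close> a property linear in \<open>a\<close> needs checking only for
  invertible \<open>a\<close>.\<close>

lemma A11_induct [consumes 2, case_names invertible zero add scale]:
  assumes "a \<in> A" "a \<in> B11"
    and inv: "\<And>a b. a \<in> A \<Longrightarrow> a \<in> B11 \<Longrightarrow> b \<in> A \<Longrightarrow> b \<in> B11 \<Longrightarrow> a * b = P \<Longrightarrow> b * a = P \<Longrightarrow> \<Phi> a"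
    and zero: "\<Phi> 0"
    and add: "\<And>x y. x \<in> A \<Longrightarrow> y \<in> A \<Longrightarrow> \<Phi> x \<Longrightarrow> \<Phi> y \<Longrightarrow> \<Phi> (x + y)"
    and scale: "\<And>c x. x \<in> A \<Longrightarrow> \<Phi> x \<Longrightarrow> \<Phi> (scale c x)"
  shows "\<Phi> a"
proof -
  have "subspace {x \<in> A. \<Phi> x}"
    by (auto intro!: subspaceI zero add scale)
  moreover have "corner_invertible P A \<subseteq> {x \<in> A. \<Phi> x}"
  proof
    fix x assume "x \<in> corner_invertible P A"
    then obtain y where "x \<in> peirce P A P" "y \<in> peirce P A P" "x * y = P" "y * x = P"
      unfolding corner_invertible_def by blast
    then show "x \<in> {x \<in> A. \<Phi> x}"
      using inv [of x y] unfolding A11_iff by blast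
  qed
  ultimately have "span (corner_invertible P A) \<subseteq> {x \<in> A. \<Phi> x}"
    by (rule span_minimal [rotated])
  moreover have "a \<in> peirce P A P" using assms(1,2) A11_iff by blast
  ultimately show ?thesis using corner_span by blast
qed

end

text \<open>The last two assumptions normalise \<open>\<delta>\<close>; subtracting an inner
  derivation achieves them. For \<open>C \<in> A\<close>, the equation \<open>P * C = C\<close>
  encodes membership in \<open>\<A>\<^sub>1\<^sub>1 + \<A>\<^sub>1\<^sub>2\<close>.\<close>

locale jordan_derivable_map = faithful_peirce scale A P Q
  for scale :: "'f::field \<Rightarrow> 'b::ring_1 \<Rightarrow> 'b" and A P Q +
  fixes \<delta> :: "'b \<Rightarrow> 'b" and C :: 'b
  assumes linear: "\<delta> \<in> linear_maps scale A"
    and derivable: "jordan_derivable_at scale A C \<delta>"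
    and C_in [simp]: "C \<in> A" and PC [simp]: "P * C = C"
    and \<delta>P_12: "P * \<delta> P * Q = 0" and \<delta>P_21: "Q * \<delta> P * P = 0"
begin

section \<open>The Jordan defect \<open>J\<close> and its homogeneous identities\<close>

lemma \<delta>_add [simp]: "X \<in> A \<Longrightarrow> Y \<in> A \<Longrightarrow> \<delta> (X + Y) = \<delta> X + \<delta> Y"
  and \<delta>_scale [simp]: "X \<in> A \<Longrightarrow> \<delta> (scale c X) = scale c (\<delta> X)"
  using linear by (auto simp: linear_maps_def)

lemma \<delta>_0 [simp]: "\<delta> 0 = 0"
  using \<delta>_add [of 0 0] by (simp del: \<delta>_add)

lemma \<delta>_minus [simp]: "X \<in> A \<Longrightarrow> \<delta> (- X) = - \<delta> X"
  using \<delta>_add [of X "- X"] by (simp del: \<delta>_add add: eq_neg_iff_add_eq_0 add.commute)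

lemma \<delta>_diff [simp]: "X \<in> A \<Longrightarrow> Y \<in> A \<Longrightarrow> \<delta> (X - Y) = \<delta> X - \<delta> Y"
  using \<delta>_add [of X "- Y"] by (simp del: \<delta>_add)

definition J :: "'b \<Rightarrow> 'b \<Rightarrow> 'b" where
  "J X Y = \<delta> (X * Y + Y * X) - (\<delta> X * Y + X * \<delta> Y + \<delta> Y * X + Y * \<delta> X)"

lemma J_eq_0: "J X Y = 0 \<longleftrightarrow> \<delta> X * Y + X * \<delta> Y + \<delta> Y * X + Y * \<delta> X = \<delta> (X * Y + Y * X)"
  by (auto simp: J_def)

lemma J_at: "X \<in> A \<Longrightarrow> Y \<in> A \<Longrightarrow> X * Y = C \<Longrightarrow> J X Y = 0"
  using derivable by (simp add: jordan_derivable_at_def J_def)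

lemma J_linear [simp]:
  assumes "X \<in> A" "Y \<in> A" "Z \<in> A"
  shows "J (X + Y) Z = J X Z + J Y Z" "J X (Y + Z) = J X Y + J X Z"
    "J (X - Y) Z = J X Z - J Y Z" "J X (Y - Z) = J X Y - J X Z"
    "J 0 X = 0" "J X 0 = 0" "J (scale c X) Y = scale c (J X Y)"
  using assms
  by (simp_all add: J_def algebra_simps scale_mult_left scale_mult_right scale_right_distrib
      scale_right_diff_distrib)

lemma J_sym: "X \<in> A \<Longrightarrow> Y \<in> A \<Longrightarrow> J X Y = J Y X"
  by (simp add: J_def algebra_simps)

text \<open>All four follow from \<open>(a + n) * (b * C + z - b * n * z) = C\<close>: here
  \<open>a * b\<close> acts as \<open>P\<close>, the products \<open>a * z\<close> and
  \<open>n * b\<close> vanish, and the two copies of \<open>n * z\<close> cancel.\<close>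

lemma
  assumes inv: "a \<in> A" "a \<in> B11" "b \<in> A" "b \<in> B11" "a * b = P"
    and m: "m \<in> A" "m \<in> B12" and w: "w \<in> A" "Q * w = w"
  shows J_inv_row2: "J a w = 0"
    and J_inv_C: "J a (b * C) = 0"
    and J_12_row2: "J m w = J a (b * m * w)"
    and J_12_quadratic: "J m (b * m * w) = 0"
proof -
  have ab: "a * (b * z) = P * z" for z
    using inv by (metis mult.assoc)
  have *: "J (a + n) (b * C + z - b * n * z) = 0"
    if "n \<in> A" "n \<in> B12" "z \<in> A" "Q * z = z" for n z
  proof (rule J_at)
    have Pz: "P * z = 0" using Q_left that by blast
    then have az: "a * z = 0" using inv by (metis B_unit(6) mult_zero_right)
    show "(a + n) * (b * C + z - b * n * z) = C"
      using that inv by (simp add: algebra_simps ab az)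
  qed (use that inv in simp_all)
  have base: "J a (b * C) = 0" "J a (b * C + w) = 0"
    using *[of 0 0] *[of 0 w] inv w by simp_all
  then show "J a (b * C) = 0" "J a w = 0"
    using inv w by simp_all
  have neg: "- m \<in> B12" "- m \<in> A"
    using m unfolding B12_iff by simp_all
  have split: "J n (b * C) + J n z = J a (b * n * z) + J n (b * n * z)"
    if n: "n \<in> A" "n \<in> B12" and z: "z \<in> A" "Q * z = z" "J a z = 0" for n z
    using *[of n z] that inv \<open>J a (b * C) = 0\<close> by (simp add: algebra_simps)
  have J_neg: "J (- m) z = - J m z" "J x (- z) = - J x z" if "z \<in> A" "x \<in> A" for z x
    using that m J_linear(3) [of 0 m z] J_linear(4) [of x 0 z] by simp_all
  have "J m (b * C) = 0"
    using split [of m 0] m inv by simp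
  then have pos: "J m w = J a (b * m * w) + J m (b * m * w)"
    using split [of m w] m w \<open>J a w = 0\<close> by simp
  \<comment> \<open>Under \<open>m\<close> to \<open>- m\<close> the quadratic term is even and the
    other two are odd, so adding both equations isolates it.\<close>
  have "- J m w = - J a (b * m * w) + J m (b * m * w)"
    using split [of "- m" w] neg m w inv \<open>J a w = 0\<close> \<open>J m (b * C) = 0\<close>
    by (simp add: J_neg)
  with pos have "J m (b * m * w) + J m (b * m * w) = 0"
    by (simp add: algebra_simps del: double_eq_0 flip: neg_eq_iff_add_eq_0)
  then show "J m (b * m * w) = 0"
    by simp
  with pos show "J m w = J a (b * m * w)" by simp
qed

lemma J_11_row2: "J a w = 0" if "a \<in> A" "a \<in> B11" "w \<in> A" "Q * w = w"
  using that(1,2)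
proof (induction rule: A11_induct)
  case (invertible a b)
  then show ?case using J_inv_row2 [of a b 0 w] that by simp
qed (use that in simp_all)

text \<open>The quadratic identity with \<open>a = b = P\<close> and \<open>w = Q\<close> reads
  \<open>J m m = 0\<close>; polarise, using the symmetry of \<open>J\<close>.\<close>

lemma J_12_12:
  assumes "m \<in> A" "m \<in> B12" "n \<in> A" "n \<in> B12"
  shows "J m n = 0"
proof -
  have J0: "J k k = 0" if "k \<in> A" "k \<in> B12" for k
    using J_12_quadratic [of P P k Q] that by simp
  have "J m n + J m n = 0"
    using J0 [of m] J0 [of n] J0 [of "m + n"] assms by (simp add: J_sym [of n m])
  then show ?thesis by simp
qed

text \<open>Thus the defect \<open>J m w\<close> depends on the product \<open>m * w\<close>
  alone.\<close>

lemma J_12_row2_P: "J m w = J P (m * w)" if "m \<in> A" "m \<in> B12" "w \<in> A" "Q * w = w"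
  using J_12_row2 [of P P m w] that by simp

section \<open>Compatibility of \<open>\<delta>\<close> with the Peirce decomposition\<close>

lemma
  shows \<delta>_P [simp]: "\<delta> P \<in> B11" and \<delta>_Q [simp]: "\<delta> Q \<in> B22"
proof -
  have "J P Q = 0" by (rule J_11_row2) simp_all
  then have eq: "\<delta> P * Q + P * \<delta> Q + \<delta> Q * P + Q * \<delta> P = 0"
    by (simp add: J_eq_0)
  have "Q * \<delta> P * Q = 0"
    using arg_cong [OF eq, of "\<lambda>X. Q * X * Q"] by (simp add: algebra_simps)
  with \<delta>P_12 \<delta>P_21 show "\<delta> P \<in> B11"
    using peirce_decomposition [of "\<delta> P"] by (metis B_basic(5) add.right_neutral)
  then have eq': "P * \<delta> Q + \<delta> Q * P = 0"
    using eq by simp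
  have "P * \<delta> Q * P = 0"
    using arg_cong [OF eq', of "\<lambda>X. P * X * P"] by (simp add: algebra_simps)
  moreover have "P * \<delta> Q * Q = 0" "Q * \<delta> Q * P = 0"
    using arg_cong [OF eq', of "\<lambda>X. P * X * Q"] arg_cong [OF eq', of "\<lambda>X. Q * X * P"]
    by (simp_all add: algebra_simps)
  ultimately show "\<delta> Q \<in> B22"
    using peirce_decomposition [of "\<delta> Q"] by (metis B_basic(8) add.left_neutral)
qed

text \<open>Since \<open>\<delta> Q\<close> lies in \<open>B22\<close>, \<open>J a Q = 0\<close>
  reduces to \<open>\<delta> a * Q + Q * \<delta> a = 0\<close>, which kills every corner of
  \<open>\<delta> a\<close> but the first.\<close>

lemma \<delta>_11 [simp]: "\<delta> a \<in> B11" if "a \<in> A" "a \<in> B11"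
proof -
  have "J a Q = 0" using that by (intro J_11_row2) simp_all
  then have eq: "\<delta> a * Q + Q * \<delta> a = 0"
    using that by (simp add: J_eq_0 add_ac)
  have "Q * \<delta> a * Q = 0"
    using arg_cong [OF eq, of "\<lambda>X. Q * X * Q"] by (simp add: algebra_simps)
  moreover have "P * \<delta> a * Q = 0" "Q * \<delta> a * P = 0"
    using arg_cong [OF eq, of "\<lambda>X. P * X * Q"] arg_cong [OF eq, of "\<lambda>X. Q * X * P"]
    by (simp_all add: algebra_simps)
  ultimately show ?thesis
    using peirce_decomposition [of "\<delta> a"] by (metis B_basic(5) add.right_neutral)
qed

lemma \<delta>_22 [simp]: "\<delta> d \<in> B22" if "d \<in> A" "d \<in> B22"
proof -
  have "J P d = 0" using that by (intro J_11_row2) simp_all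
  then have eq: "P * \<delta> d + \<delta> d * P = 0"
    using that by (simp add: J_eq_0 add_ac)
  have "P * \<delta> d * P = 0"
    using arg_cong [OF eq, of "\<lambda>X. P * X * P"] by (simp add: algebra_simps)
  moreover have "P * \<delta> d * Q = 0" "Q * \<delta> d * P = 0"
    using arg_cong [OF eq, of "\<lambda>X. P * X * Q"] arg_cong [OF eq, of "\<lambda>X. Q * X * P"]
    by (simp_all add: algebra_simps)
  ultimately show ?thesis
    using peirce_decomposition [of "\<delta> d"] by (metis B_basic(8) add.left_neutral)
qed

lemma J_11_21: "J a s = 0" if "a \<in> A" "a \<in> B11" "s \<in> A" "s \<in> B21"
  using that by (intro J_11_row2) simp_all

lemma \<delta>_21 [simp]:
  assumes s: "s \<in> A" "s \<in> B21"
  shows "\<delta> s \<in> B21"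
proof -
  have P_eq: "\<delta> t = t * \<delta> P + P * \<delta> t + \<delta> t * P" if "t \<in> A" "t \<in> B21" for t
    using J_11_21 [of P t] that by (simp add: J_eq_0 add_ac)
  have 11: "P * \<delta> s * P = 0"
    using arg_cong [OF P_eq [OF s], of "\<lambda>X. P * X * P"] s by (simp add: algebra_simps)
  have 22: "Q * \<delta> s * Q = 0"
    using arg_cong [OF P_eq [OF s], of "\<lambda>X. Q * X * Q"] s by (simp add: algebra_simps)
  \<comment> \<open>The \<open>B12\<close> component turns right multiplication by \<open>a\<close>
    into left multiplication.\<close>
  have reverse: "P * \<delta> (t * a) * Q = a * (P * \<delta> t * Q)"
    if "t \<in> A" "t \<in> B21" "a \<in> A" "a \<in> B11" for t a
  proof -
    have "\<delta> (t * a) = t * \<delta> a + a * \<delta> t + \<delta> t * a"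
      using J_11_21 [of a t] that by (simp add: J_eq_0 algebra_simps)
    then show ?thesis
      using that by (simp add: algebra_simps)
  qed
  \<comment> \<open>Moving \<open>b * a\<close> across at once, or \<open>a\<close> and then
    \<open>b\<close>, gives opposite orders.\<close>
  have "P * \<delta> s * Q = 0"
  proof (rule separated)
    fix a b assume ab: "a \<in> A" "a \<in> B11" "b \<in> A" "b \<in> B11"
    have "P * \<delta> (s * (b * a)) * Q = b * a * (P * \<delta> s * Q)"
      by (rule reverse) (use s ab in simp_all)
    moreover have "P * \<delta> (s * b * a) * Q = a * (P * \<delta> (s * b) * Q)"
      by (rule reverse) (use s ab in simp_all)
    moreover have "P * \<delta> (s * b) * Q = b * (P * \<delta> s * Q)"
      by (rule reverse) (use s ab in simp_all)
    ultimately show "a * b * (P * \<delta> s * Q) = b * a * (P * \<delta> s * Q)"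
      by (simp only: mult.assoc)
  qed simp
  with 11 22 show "\<delta> s \<in> B21"
    using peirce_decomposition [of "\<delta> s"] by (metis B_basic(7) add.right_neutral add.left_neutral)
qed

text \<open>Compare corners in \<open>J m Q = J P m\<close>. The corner from \<open>Q\<close> to
  \<open>P\<close> yields only a trivial equation, so \<open>Q * \<delta> m * P\<close> needs a
  separate argument.\<close>

lemma
  assumes m: "m \<in> A" "m \<in> B12"
  shows \<delta>_12_diag: "P * \<delta> m * P = 0" "Q * \<delta> m * Q = 0"
    and \<delta>P_m: "\<delta> P * m = m * \<delta> Q"
proof -
  have "J m Q = J P m"
    using J_12_row2_P [of m Q] m by simp
  then have eq: "\<delta> m * Q + m * \<delta> Q + Q * \<delta> m = \<delta> P * m + P * \<delta> m + \<delta> m * P"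
    using m by (simp add: J_def algebra_simps)
  show "P * \<delta> m * P = 0"
    using arg_cong [OF eq, of "\<lambda>X. P * X * P"] m by (simp add: algebra_simps)
  show "Q * \<delta> m * Q = 0"
    using arg_cong [OF eq, of "\<lambda>X. Q * X * Q"] m by (simp add: algebra_simps)
  show "\<delta> P * m = m * \<delta> Q"
    using arg_cong [OF eq, of "\<lambda>X. P * X * Q"] m by (simp add: algebra_simps)
qed

lemma \<delta>_12_eq: "\<delta> m = P * \<delta> m * Q + Q * \<delta> m * P" if "m \<in> A" "m \<in> B12"
  using peirce_decomposition [of "\<delta> m"] \<delta>_12_diag [OF that] by simp

text \<open>For invertible \<open>a\<close>, \<open>J (a * m) Q\<close> equals both
  \<open>J a m\<close> and \<open>J P (a * m)\<close>; the claim is linear in \<open>a\<close>. The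
  terms with \<open>\<delta> P\<close> and \<open>Q * \<delta> m * P\<close> are deviations from the
  product rule that are later shown to vanish.\<close>

lemma \<delta>_11_12_raw:
  assumes m: "m \<in> A" "m \<in> B12" and a: "a \<in> A" "a \<in> B11"
  shows "\<delta> (a * m) = \<delta> a * m + a * (P * \<delta> m * Q) - \<delta> P * a * m + Q * \<delta> m * P * a"
  using a
proof (induction rule: A11_induct)
  case (invertible a b)
  have "J (a * m) Q = J a (b * (a * m) * Q)" "J (a * m) Q = J P (a * m)"
    using J_12_row2 [of a b "a * m" Q] J_12_row2_P [of "a * m" Q] invertible m by simp_all
  moreover have "b * (a * m) = m"
    using invertible m by (simp add: mult.assoc [symmetric])
  ultimately have "J a m = J P (a * m)"
    using m by (simp add: mult.assoc)
  then have "\<delta> a * m + a * \<delta> m + \<delta> m * a = \<delta> P * (a * m) + P * \<delta> (a * m) + \<delta> (a * m) * P"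
    using invertible m by (simp add: J_def algebra_simps)
  moreover have "P * \<delta> (a * m) + \<delta> (a * m) * P = \<delta> (a * m)"
    by (subst (1 2 3) \<delta>_12_eq) (use invertible m in \<open>simp_all add: algebra_simps\<close>)
  moreover have "a * \<delta> m = a * (P * \<delta> m * Q)" "\<delta> m * a = Q * \<delta> m * P * a"
    by (subst \<delta>_12_eq; use invertible m in \<open>simp add: algebra_simps\<close>)+
  ultimately show ?case
    by (simp add: algebra_simps)
next
  case (scale c x)
  then show ?case
    using m by (simp add: scale_mult_left scale_mult_right scale_right_distrib
        scale_right_diff_distrib)
qed (use m in \<open>simp_all add: algebra_simps\<close>)

text \<open>The unwanted component \<open>\<phi> m\<close> lies in \<open>B21\<close>, where the
  corner acts on the right and separation does not apply directly. The products
  \<open>n * \<phi> m * k\<close> lie in \<open>B12\<close> and replace it.\<close>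

lemma \<delta>_12 [simp]: "\<delta> m \<in> B12" if m: "m \<in> A" "m \<in> B12"
proof -
  define \<phi> where "\<phi> n = Q * \<delta> n * P" for n
  have \<phi>_B [simp]: "\<phi> n \<in> B21" for n
    by (simp add: \<phi>_def)
  have reverse: "\<phi> (a * n) = \<phi> n * a" if "n \<in> A" "n \<in> B12" "a \<in> A" "a \<in> B11" for n a
    using arg_cong [OF \<delta>_11_12_raw [OF that], of "\<lambda>X. Q * X * P"] that
    by (simp add: \<phi>_def algebra_simps)
  \<comment> \<open>This is the first corner of \<open>J n k = 0\<close>, where \<open>n * k\<close>
    and \<open>k * n\<close> vanish.\<close>
  have anti: "n * \<phi> k = - (k * \<phi> n)" if "n \<in> A" "n \<in> B12" "k \<in> A" "k \<in> B12" for n k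
  proof -
    have eq: "\<delta> n * k + n * \<delta> k + \<delta> k * n + k * \<delta> n = 0"
      using J_12_12 [OF that] that by (simp add: J_eq_0)
    have "n * (\<delta> k * P) + k * (\<delta> n * P) = 0"
      using arg_cong [OF eq, of "\<lambda>X. P * X * P"] that by (simp add: algebra_simps)
    then show ?thesis
      using that by (simp add: \<phi>_def mult.assoc eq_neg_iff_add_eq_0)
  qed
  have "n * \<phi> m = 0" if n: "n \<in> A" "n \<in> B12" for n
  proof (rule faithful_left)
    show "n * \<phi> m * P = n * \<phi> m" using n by (simp add: mult.assoc)
    \<comment> \<open>Apply \<open>anti\<close>, then \<open>reverse\<close>, then
      \<open>anti\<close> again; the signs cancel.\<close>
    have commute: "a * (n * \<phi> m) = n * \<phi> m * a" if "a \<in> A" "a \<in> B11" for a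
    proof -
      have "a * (n * \<phi> m) = - (m * (\<phi> n * a))"
        using anti [of "a * n" m] reverse [of n a] that n m by (simp add: mult.assoc)
      also have "\<dots> = n * \<phi> m * a"
        using anti [of n m] n m by (simp add: mult.assoc [symmetric])
      finally show ?thesis .
    qed
    \<comment> \<open>Evaluate \<open>\<phi> (a * b * m)\<close> in one step and in two.\<close>
    have kill: "\<phi> m * (a * b) = \<phi> m * (b * a)"
      if "a \<in> A" "a \<in> B11" "b \<in> A" "b \<in> B11" for a b
      using reverse [of m "a * b"] reverse [of "b * m" a] reverse [of m b] that m
      by (simp add: mult.assoc)
    fix k assume k: "k \<in> A" "k \<in> B12"
    show "n * \<phi> m * k = 0"
    proof (rule separated)
      show "n * \<phi> m * k \<in> B12" using n k by simp
      fix a b assume ab: "a \<in> A" "a \<in> B11" "b \<in> A" "b \<in> B11"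
      have "a * b * (n * \<phi> m) = n * (\<phi> m * (a * b))"
        using commute [of "a * b"] ab by (simp add: mult.assoc)
      also have "\<dots> = b * a * (n * \<phi> m)"
        using commute [of "b * a"] kill ab by (simp add: mult.assoc)
      finally show "a * b * (n * \<phi> m * k) = b * a * (n * \<phi> m * k)"
        by (simp add: mult.assoc [symmetric])
    qed
  qed
  then have "\<phi> m = 0"
    using faithful_right [of "\<phi> m"] by simp
  then show ?thesis
    using \<delta>_12_eq [OF m] by (metis \<phi>_def B_basic(6) add.right_neutral)
qed

section \<open>The values of \<open>\<delta>\<close> at \<open>P\<close> and
  \<open>Q\<close>\<close>

lemma
  shows \<delta>P_commute: "a \<in> A \<Longrightarrow> a \<in> B11 \<Longrightarrow> \<delta> P * a = a * \<delta> P"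
    and \<delta>Q_commute: "d \<in> A \<Longrightarrow> d \<in> B22 \<Longrightarrow> \<delta> Q * d = d * \<delta> Q"
proof -
  assume a: "a \<in> A" "a \<in> B11"
  have "\<delta> P * a - a * \<delta> P = 0"
  proof (rule faithful_left)
    fix m assume m: "m \<in> A" "m \<in> B12"
    \<comment> \<open>\<open>\<delta> P * a * m = a * m * \<delta> Q = a * \<delta> P * m\<close>,
      by \<open>\<delta>P_m\<close> for \<open>a * m\<close> and for \<open>m\<close>.\<close>
    show "(\<delta> P * a - a * \<delta> P) * m = 0"
      using \<delta>P_m [of m] \<delta>P_m [of "a * m"] a m by (simp add: algebra_simps)
  qed (use a in \<open>simp add: algebra_simps\<close>)
  then show "\<delta> P * a = a * \<delta> P" by simp
next
  assume d: "d \<in> A" "d \<in> B22"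
  have "\<delta> Q * d - d * \<delta> Q = 0"
  proof (rule faithful_right)
    fix m assume m: "m \<in> A" "m \<in> B12"
    show "m * (\<delta> Q * d - d * \<delta> Q) = 0"
      using \<delta>P_m [of m] \<delta>P_m [of "m * d"] d m by (simp add: algebra_simps) (metis mult.assoc)
  qed (use d in \<open>simp add: algebra_simps\<close>)
  then show "\<delta> Q * d = d * \<delta> Q" by simp
qed

text \<open>The sum \<open>\<delta> P + \<delta> Q\<close> commutes with both diagonal corners of
  \<open>A\<close>, and with \<open>\<A>\<^sub>1\<^sub>2\<close> by \<open>\<delta>P_m\<close>,
  hence with the triangular part.\<close>

lemma \<delta>_1_scalar: obtains l where "\<delta> P = scale l P" "\<delta> Q = scale l Q"
proof -
  have "\<delta> P + \<delta> Q \<in> centralizer (triangular_part P A)"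
    unfolding centralizer_def triangular_part_def Q_eq [symmetric]
  proof clarify
    fix X assume X: "X \<in> A" "Q * X * P = 0"
    define a m d where "a = P * X * P" and "m = P * X * Q" and "d = Q * X * Q"
    have amd: "a \<in> A" "a \<in> B11" "m \<in> A" "m \<in> B12" "d \<in> A" "d \<in> B22"
      using X by (simp_all add: a_def m_def d_def)
    have "X = a + m + d"
      using peirce_decomposition [of X] X by (simp add: a_def m_def d_def)
    then show "X * (\<delta> P + \<delta> Q) = (\<delta> P + \<delta> Q) * X"
      using amd \<delta>P_commute [of a] \<delta>Q_commute [of d] \<delta>P_m [of m] by (simp add: algebra_simps)
  qed
  then obtain l where l: "\<delta> P + \<delta> Q = scale l 1"
    using centre by auto
  show thesis
  proof (rule that)
    show "\<delta> P = scale l P"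
      using arg_cong [OF l, of "\<lambda>X. P * X"] by (simp add: algebra_simps scale_mult_right)
    show "\<delta> Q = scale l Q"
      using arg_cong [OF l, of "\<lambda>X. Q * X"] by (simp add: algebra_simps scale_mult_right)
  qed
qed

lemma \<delta>_11_12:
  assumes "a \<in> A" "a \<in> B11" "m \<in> A" "m \<in> B12"
  shows "\<delta> (a * m) = \<delta> a * m + a * \<delta> m - \<delta> P * a * m"
  using \<delta>_11_12_raw [OF assms(3,4,1,2)] assms by simp

lemma \<delta>_P_0 [simp]: "\<delta> P = 0"
proof -
  obtain l where l: "\<delta> P = scale l P" "\<delta> Q = scale l Q"
    by (rule \<delta>_1_scalar)
  have "l = 0"
  \<comment> \<open>Here \<open>C\<close> itself is needed again. For \<open>C \<noteq> 0\<close>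
    the factorisation \<open>P * C = C\<close> forces \<open>scale l C = 0\<close>; for
    \<open>C = 0\<close> it is uninformative, and \<open>m * P = 0\<close> gives
    \<open>scale l m = 0\<close> instead.\<close>
  proof (cases "C = 0")
    case True
    show ?thesis
    proof (rule ccontr)
      assume "l \<noteq> 0"
      have "P * m = 0" if m: "m \<in> A" "m \<in> B12" for m
      proof -
        have "J m P = 0" using m True by (intro J_at) simp_all
        then have "scale l m = 0" using m by (simp add: J_eq_0 l scale_mult_left scale_mult_right)
        then show ?thesis using \<open>l \<noteq> 0\<close> m by simp
      qed
      then have "P = 0" by (rule faithful_left [rotated]) simp_all
      then show False using P_neq_0 by simp
    qed
  next
    case False
    define a m where "a = C * P" and "m = C * Q"
    have am: "a \<in> A" "a \<in> B11" "m \<in> A" "m \<in> B12"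
      unfolding a_def m_def B_iffs
      by (simp_all add: mult.assoc) (simp_all add: mult.assoc [symmetric])
    have C: "C = a + m"
      by (simp add: a_def m_def distrib_left [symmetric] PQ)
    have "J P C = 0"
      using J_inv_C [of P P 0 0] by simp
    moreover have "J P C = - (scale l a + scale l a + scale l m)"
      using am by (simp add: C J_def l scale_mult_left scale_mult_right algebra_simps)
    ultimately have eq: "scale l a + scale l a + scale l m = 0"
      by (metis neg_equal_0_iff_equal)
    have "scale l a = 0"
      using arg_cong [OF eq, of "\<lambda>X. X * P"] am
      by (simp add: scale_mult_left algebra_simps)
    with eq have "scale l C = 0" by (auto simp: C)
    with False show ?thesis by simp
  qed
  with l show ?thesis by simp
qed

lemma \<delta>_Q_0 [simp]: "\<delta> Q = 0"
proof (rule faithful_right)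
  fix m assume "m \<in> A" "m \<in> B12"
  then show "m * \<delta> Q = 0" using \<delta>P_m [of m] by simp
qed simp

section \<open>The product rule on pairs of corners\<close>

lemma \<delta>_mult_11_12: "\<delta> (a * m) = \<delta> a * m + a * \<delta> m"
  if "a \<in> A" "a \<in> B11" "m \<in> A" "m \<in> B12"
  using \<delta>_11_12 that by simp

text \<open>Expanding \<open>\<delta> (a * b * m)\<close> with both bracketings shows that the
  deviation annihilates \<open>\<A>\<^sub>1\<^sub>2\<close>.\<close>

lemma \<delta>_mult_11_11: "\<delta> (a * b) = \<delta> a * b + a * \<delta> b"
  if ab: "a \<in> A" "a \<in> B11" "b \<in> A" "b \<in> B11"
proof -
  have "\<delta> (a * b) - \<delta> a * b - a * \<delta> b = 0"
  proof (rule faithful_left)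
    fix m assume m: "m \<in> A" "m \<in> B12"
    show "(\<delta> (a * b) - \<delta> a * b - a * \<delta> b) * m = 0"
      using \<delta>_mult_11_12 [of "a * b" m] \<delta>_mult_11_12 [of a "b * m"] \<delta>_mult_11_12 [of b m] ab m
      by (simp add: algebra_simps)
  qed (use ab in \<open>simp add: algebra_simps\<close>)
  then show ?thesis by (simp add: algebra_simps)
qed

text \<open>\<open>J P (m * d)\<close> vanishes because \<open>\<delta> P = 0\<close> and
  \<open>\<delta> (m * d)\<close> lies in \<open>B12\<close>.\<close>

lemma \<delta>_mult_12_22: "\<delta> (m * d) = \<delta> m * d + m * \<delta> d"
  if "m \<in> A" "m \<in> B12" "d \<in> A" "d \<in> B22"
  using J_12_row2_P [of m d] that by (simp add: J_def algebra_simps)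

lemma \<delta>_mult_22_22: "\<delta> (c * d) = \<delta> c * d + c * \<delta> d"
  if cd: "c \<in> A" "c \<in> B22" "d \<in> A" "d \<in> B22"
proof -
  have "\<delta> (c * d) - \<delta> c * d - c * \<delta> d = 0"
  proof (rule faithful_right)
    fix m assume m: "m \<in> A" "m \<in> B12"
    show "m * (\<delta> (c * d) - \<delta> c * d - c * \<delta> d) = 0"
      using \<delta>_mult_12_22 [of m "c * d"] \<delta>_mult_12_22 [of "m * c" d] \<delta>_mult_12_22 [of m c] cd m
      by (simp add: algebra_simps)
  qed (use cd in \<open>simp add: algebra_simps\<close>)
  then show ?thesis by (simp add: algebra_simps)
qed

lemma \<delta>_mult_21_11: "\<delta> (s * a) = \<delta> s * a + s * \<delta> a"
  if "s \<in> A" "s \<in> B21" "a \<in> A" "a \<in> B11"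
  using J_11_21 [of a s] that by (simp add: J_eq_0 algebra_simps)

text \<open>One Jordan identity yields both rules: \<open>m * s\<close> and \<open>s * m\<close> lie
  in different diagonal corners, so multiplication by \<open>P\<close> and by \<open>Q\<close>
  separates them.\<close>

lemma
  assumes ms: "m \<in> A" "m \<in> B12" "s \<in> A" "s \<in> B21"
  shows \<delta>_mult_12_21: "\<delta> (m * s) = \<delta> m * s + m * \<delta> s"
    and \<delta>_mult_21_12: "\<delta> (s * m) = \<delta> s * m + s * \<delta> m"
proof -
  have "J m s = J P (m * s)"
    using ms by (intro J_12_row2_P) simp_all
  also have "\<dots> = 0"
    using ms by (simp add: J_def)
  finally have eq: "\<delta> (m * s) + \<delta> (s * m) = \<delta> m * s + m * \<delta> s + \<delta> s * m + s * \<delta> m"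
    using ms by (simp add: J_def)
  show "\<delta> (m * s) = \<delta> m * s + m * \<delta> s"
    using arg_cong [OF eq, of "\<lambda>X. P * X"] ms by (simp add: algebra_simps)
  show "\<delta> (s * m) = \<delta> s * m + s * \<delta> m"
    using arg_cong [OF eq, of "\<lambda>X. Q * X"] ms by (simp add: algebra_simps)
qed

lemma \<delta>_mult_22_21: "\<delta> (d * s) = \<delta> d * s + d * \<delta> s"
  if ds: "d \<in> A" "d \<in> B22" "s \<in> A" "s \<in> B21"
proof -
  have "\<delta> (d * s) - \<delta> d * s - d * \<delta> s = 0"
  proof (rule faithful_right)
    fix m assume m: "m \<in> A" "m \<in> B12"
    show "m * (\<delta> (d * s) - \<delta> d * s - d * \<delta> s) = 0"
      using \<delta>_mult_12_21 [of m "d * s"] \<delta>_mult_12_21 [of "m * d" s] \<delta>_mult_12_22 [of m d] ds m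
      by (simp add: algebra_simps)
  qed (use ds in \<open>simp add: algebra_simps\<close>)
  then show ?thesis by (simp add: algebra_simps)
qed

lemma A_decompose:
  assumes "X \<in> A"
  obtains a m s d where "X = a + m + s + d" "a \<in> A" "a \<in> B11" "m \<in> A" "m \<in> B12"
    "s \<in> A" "s \<in> B21" "d \<in> A" "d \<in> B22"
  by (rule that [OF peirce_decomposition]) (use assms in simp_all)

text \<open>Of the sixteen products of components, eight are covered by the rules above; for the
  other eight both sides vanish by orthogonality.\<close>

lemma \<delta>_mult:
  assumes "X \<in> A" "Y \<in> A"
  shows "\<delta> (X * Y) = \<delta> X * Y + X * \<delta> Y"
proof -
  obtain a m s d where X: "X = a + m + s + d" and
    [simp]: "a \<in> A" "a \<in> B11" "m \<in> A" "m \<in> B12" "s \<in> A" "s \<in> B21" "d \<in> A" "d \<in> B22"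
    using assms(1) by (rule A_decompose)
  obtain a' m' s' d' where Y: "Y = a' + m' + s' + d'" and
    [simp]: "a' \<in> A" "a' \<in> B11" "m' \<in> A" "m' \<in> B12" "s' \<in> A" "s' \<in> B21" "d' \<in> A" "d' \<in> B22"
    using assms(2) by (rule A_decompose)
  show ?thesis
    by (simp add: X Y distrib_left distrib_right \<delta>_mult_11_11 \<delta>_mult_11_12 \<delta>_mult_12_21
        \<delta>_mult_12_22 \<delta>_mult_21_11 \<delta>_mult_21_12 \<delta>_mult_22_21 \<delta>_mult_22_22 add_ac)
qed

end

section \<open>Normalisation by an inner derivation, and the conclusion\<close>

theorem (in faithful_peirce) jordan_derivable_imp_derivation:
  assumes linear: "\<delta> \<in> linear_maps scale A" and derivable: "jordan_derivable_at scale A C \<delta>"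
    and C: "C \<in> A" "P * C = C"
  shows "derivation scale A \<delta>"
proof -
  \<comment> \<open>\<open>P * M - M * P\<close> is exactly the off-diagonal part of
    \<open>\<delta> P\<close>, so \<open>\<epsilon> P\<close> has none.\<close>
  define M where "M = P * \<delta> P * Q - Q * \<delta> P * P"
  define \<epsilon> where "\<epsilon> X = \<delta> X - (X * M - M * X)" for X
  have lin: "\<epsilon> \<in> linear_maps scale A"
    using linear by (simp add: linear_maps_def \<epsilon>_def algebra_simps scale_mult_left
        scale_mult_right scale_right_diff_distrib scale_right_distrib)
  have "jordan_derivable_at scale A C \<epsilon>"
    unfolding jordan_derivable_at_def
  proof (intro conjI ballI impI lin)
    fix X Y assume XY: "X \<in> A" "Y \<in> A" "X * Y = C"
    then have "\<delta> (X * Y + Y * X) = \<delta> X * Y + X * \<delta> Y + \<delta> Y * X + Y * \<delta> X"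
      using derivable unfolding jordan_derivable_at_def by blast
    then show "\<epsilon> (X * Y + Y * X) = \<epsilon> X * Y + X * \<epsilon> Y + \<epsilon> Y * X + Y * \<epsilon> X"
      by (simp add: \<epsilon>_def algebra_simps)
  qed
  moreover have "P * \<epsilon> P * Q = 0" "Q * \<epsilon> P * P = 0"
    by (simp_all add: \<epsilon>_def M_def algebra_simps)
  ultimately interpret jordan_derivable_map scale A P Q \<epsilon> C
    using lin C by unfold_locales
  \<comment> \<open>The subtracted map satisfies the product rule, so the rule passes from
    \<open>\<epsilon>\<close> back to \<open>\<delta>\<close>.\<close>
  have "\<delta> (X * Y) = \<delta> X * Y + X * \<delta> Y" if "X \<in> A" "Y \<in> A" for X Y
    using \<delta>_mult [OF that] by (simp add: \<epsilon>_def algebra_simps)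
  then show ?thesis
    using assms(1) by (simp add: derivation_def)
qed

lemma (in unital_algebra) derivation_imp_jordan_derivation:
  assumes "unital_subalgebra scale A" "derivation scale A \<delta>"
  shows "jordan_derivation scale A \<delta>"
  using assms
  by (auto simp: derivation_def jordan_derivation_def linear_maps_def unital_subalgebra_def add_ac)

theorem theorem2p9:
  fixes scale :: "'f::field \<Rightarrow> 'b::ring_1 \<Rightarrow> 'b"
    and A :: "'b set" and P Q :: 'b
  assumes "CHAR('f) \<noteq> 2"
    and "infinite (UNIV :: 'f set) \<or> card (UNIV :: 'f set) \<ge> 4"
    and "unital_algebra scale"
    and "unital_subalgebra scale A"
    and "P \<in> A" and "P * P = P" and "P \<noteq> 0" and "P \<noteq> 1"
    and "Q = 1 - P"
    and "peirce P A P \<subseteq> module.span scale (corner_invertible P A)"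
    and "peirce Q A Q \<subseteq> module.span scale (corner_invertible Q A)"
    and "faithful_corner P A"
    and "centralizer (triangular_part P A) = range (\<lambda>c. scale c 1)"
    and "separates (commutators (peirce P A P)) (peirce P UNIV Q)"
  shows "(\<forall>\<delta>\<in>linear_maps scale A.
            (\<exists>C\<in>peirce P A P + peirce P A Q. jordan_derivable_at scale A C \<delta>)
              \<longrightarrow> derivation scale A \<delta>) \<and>
         (\<forall>C\<in>peirce P A P + peirce P A Q. jordan_all_derivable_point scale A C)"
proof -
  interpret unital_algebra scale by fact
  interpret faithful_peirce scale A P Q
    using assms by unfold_locales
  have C: "C \<in> A \<and> P * C = C" if "C \<in> peirce P A P + peirce P A Q" for C
    using that by (auto elim!: set_plus_elim simp: A11_iff A12_iff distrib_left)
  have "derivation scale A \<delta>"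
    if "\<delta> \<in> linear_maps scale A" "C \<in> peirce P A P + peirce P A Q"
      "jordan_derivable_at scale A C \<delta>" for \<delta> C
    using jordan_derivable_imp_derivation that C by blast
  then show ?thesis
    using derivation_imp_jordan_derivation assms(4) C
    unfolding jordan_all_derivable_point_def by blast
qed

end
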